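(* With the family of matrices $\mathcal{A}$, $\mathcal{P}_t$, $\mathcal{H}$ defined in the context, there exist positive constants $C_0$ and $C_1$, independent of $h$, such that $C_0\mathcal{H}\le\mathcal{H}\mathcal{P}_t^{-1}\mathcal{A}\le C_1\mathcal{H}$, and the spectrum of $\mathcal{P}_t^{-1}\mathcal{A}$ is bounded by these constants: $$\sigma\left(\mathcal{P}_t^{-1}\mathcal{A}\right)\subset[C_0,C_1].$$
   Context: Let $\Omega\subset\mathbb{R}^d$, $1\le d\le 3$, be a domain, let ${\bf D}{\bf u}=(\nabla{\bf u}+(\nabla{\bf u})^T)/2$, and let $L^2_0(\Omega)=\{q\in L^2(\Omega):\int_\Omega q\,dx=0\}$. Let $({\bf X}_h, M_h)_h$ be a family, indexed by mesh size $h$, of pairs of finite-dimensional spaces ${\bf X}_h\subset H_0^1(\Omega)^d$ and $M_h\subset H^1(\Omega)\cap L^2_0(\Omega)$ with bases, $n_u=\dim {\bf X}_h$, $n_p=\dim M_h$. The matrices $K\in\mathbb{R}^{n_u\times n_u}$, $G\in\mathbb{R}^{n_p\times n_u}$, $C,Q\in\mathbb{R}^{n_p\times n_p}$ are the matrices, with respect to these bases, of the bilinear forms $({\bf u},{\bf v})\mapsto\int_\Omega {\bf D}{\bf u}:{\bf D}{\bf v}\,dx-\int_\Omega\tfrac13(\nabla\cdot{\bf u})(\nabla\cdot{\bf v})\,dx$, $(q,{\bf v})\mapsto-\int_\Omega q\,\nabla\cdot{\bf v}\,dx$, $(p,q)\mapsto\int_\Omega\nabla p\cdot\nabla q\,dx$,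 and $(p,q)\mapsto\int_\Omega pq\,dx$, respectively; $K$ and $Q$ are symmetric positive definite and $C$ is symmetric positive semi-definite. Constants $0<\eta,\zeta<\infty$ and $0\le k<\infty$ are given. Standing assumption (inf-sup stability): $G^T$ is injective on $\mathbb{R}^{n_p}$ and there are positive constants $c_g,c^g$ independent of $h$ with $c_g\langle Qq,q\rangle\le\langle GK^{-1}G^Tq,q\rangle\le c^g\langle Qq,q\rangle$ for all $q$. Set $R=-\eta^{-1}Q-kC$ and $S=-\left((2\eta)^{-1}+\zeta^{-1}\right)Q$. Let $\mathcal{K},\mathcal{R},\mathcal{S}$ be symmetric matrices, $\mathcal{K}$ positive definite and $\mathcal{R},\mathcal{S}$ negative definite, such that for all nonzero $q$ $$c_k\le\frac{\langle Kq,q\rangle}{\langle\mathcal{K}q,q\rangle}\le c^k,\quad c_r\le\frac{\langle Rq,q\rangle}{\langle\mathcal{R}q,q\rangle}\le c^r,\quad c_s\le\frac{\langle Sq,q\rangle}{\langle\mathcal{S}q,q\rangle}\le c^s,$$ with positive constants $c_k,c^k,c_r,c^r,c_s,c^s$ independent of $h,k,\eta,\zeta$, and assume $c_k>1$. Define $$\mathcal{A}=\begin{bmatrix}\eta K & G^T & G^T \\ G & -kC & 0 \\ G & 0 & -\zeta^{-1}Q\end{bmatrix},\quad \mathcal{P}_t=\begin{bmatrix}\eta\mathcal{K} & 0 & 0 \\ G & \mathcal{R} & 0 \\ G & 0 & \mathcal{S}\end{bmatrix},\quad \mathcal{H}=\begin{bmatrix}\eta(K-\mathcal{K}) & 0 &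 0 \\ 0 & -\mathcal{R} & 0 \\ 0 & 0 & -\mathcal{S}\end{bmatrix}.$$ $A\le B$ means that $B-A$ is symmetric positive semi-definite. *)

theory Defs
  imports
    "HOL-Analysis.Analysis"
    "Jordan_Normal_Form.Gauss_Jordan_Elimination"
    "Jordan_Normal_Form.Spectral_Radius"
begin

unbundle no vec_syntax
unbundle no inner_syntax

section \<open>Sobolev spaces on a domain\<close>

text \<open>
  Elements of $L^2(\Omega)$, $H^1(\Omega)$, \dots\ are represented by functions on the whole
  space; only their values on $\Omega$ matter, and equality means equality almost
  everywhere on $\Omega$.
\<close>

definition is_domain :: "(real ^ 'd) set \<Rightarrow> bool" where
  "is_domain \<Omega> \<longleftrightarrow> open \<Omega> \<and> connected \<Omega> \<and> \<Omega> \<noteq> {}"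

definition partial_deriv :: "'d \<Rightarrow> (real ^ 'd \<Rightarrow> real) \<Rightarrow> real ^ 'd \<Rightarrow> real" where
  "partial_deriv i f x = frechet_derivative f (at x) (axis i 1)"

primrec C_fun :: "nat \<Rightarrow> (real ^ 'd \<Rightarrow> real) \<Rightarrow> bool" where
  "C_fun 0 f \<longleftrightarrow> continuous_on UNIV f"
| "C_fun (Suc m) f \<longleftrightarrow> (\<forall>x. f differentiable (at x)) \<and> (\<forall>i. C_fun m (partial_deriv i f))"

text \<open>$C_c^\infty(\Omega)$, each function being extended by zero to the whole space.\<close>

definition test_fun :: "(real ^ 'd) set \<Rightarrow> (real ^ 'd \<Rightarrow> real) \<Rightarrow> bool" where
  "test_fun \<Omega> \<phi> \<longleftrightarrow> (\<forall>m. C_fun m \<phi>)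
     \<and> compact (closure {x. \<phi> x \<noteq> 0}) \<and> closure {x. \<phi> x \<noteq> 0} \<subseteq> \<Omega>"

definition L2 :: "(real ^ 'd) set \<Rightarrow> (real ^ 'd \<Rightarrow> real) set" where
  "L2 \<Omega> = {u. u \<in> borel_measurable (lebesgue_on \<Omega>)
            \<and> integrable (lebesgue_on \<Omega>) (\<lambda>x. (u x)\<^sup>2)}"

text \<open>On a domain of infinite measure, the condition $\int_\Omega q\,dx = 0$ includes
  that \<open>q\<close> is integrable.\<close>

definition L2_0 :: "(real ^ 'd) set \<Rightarrow> (real ^ 'd \<Rightarrow> real) set" where
  "L2_0 \<Omega> = {q \<in> L2 \<Omega>. has_bochner_integral (lebesgue_on \<Omega>) q 0}"

definition is_weak_deriv ::
  "(real ^ 'd) set \<Rightarrow> 'd \<Rightarrow> (real ^ 'd \<Rightarrow> real) \<Rightarrow> (real ^ 'd \<Rightarrow> real) \<Rightarrow> bool" where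
  "is_weak_deriv \<Omega> i u g \<longleftrightarrow> g \<in> L2 \<Omega> \<and>
     (\<forall>\<phi>. test_fun \<Omega> \<phi> \<longrightarrow>
        (LINT x|lebesgue_on \<Omega>. u x * partial_deriv i \<phi> x)
          = - (LINT x|lebesgue_on \<Omega>. g x * \<phi> x))"

definition H1 :: "(real ^ 'd) set \<Rightarrow> (real ^ 'd \<Rightarrow> real) set" where
  "H1 \<Omega> = {u \<in> L2 \<Omega>. \<forall>i. \<exists>g. is_weak_deriv \<Omega> i u g}"

text \<open>A representative of the weak partial derivative; for \<open>u\<close> in \<open>H1 \<Omega>\<close> it is unique up
  to null sets, so the integrals below do not depend on the choice.\<close>

definition weak_deriv ::
  "(real ^ 'd) set \<Rightarrow> 'd \<Rightarrow> (real ^ 'd \<Rightarrow> real) \<Rightarrow> real ^ 'd \<Rightarrow> real" where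
  "weak_deriv \<Omega> i u = (SOME g. is_weak_deriv \<Omega> i u g)"

text \<open>The closure of the test functions in the $H^1$ norm.\<close>

definition H1_0 :: "(real ^ 'd) set \<Rightarrow> (real ^ 'd \<Rightarrow> real) set" where
  "H1_0 \<Omega> = {u \<in> H1 \<Omega>. \<forall>\<epsilon>>0. \<exists>\<phi>. test_fun \<Omega> \<phi> \<and>
      (LINT x|lebesgue_on \<Omega>. (u x - \<phi> x)\<^sup>2)
      + (\<Sum>i\<in>UNIV. LINT x|lebesgue_on \<Omega>. (weak_deriv \<Omega> i u x - partial_deriv i \<phi> x)\<^sup>2) < \<epsilon>}"

definition H1_0_vec :: "(real ^ 'd) set \<Rightarrow> (real ^ 'd \<Rightarrow> real ^ 'd) set" where
  "H1_0_vec \<Omega> = {u. \<forall>i. (\<lambda>x. vec_nth (u x) i) \<in> H1_0 \<Omega>}"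

section \<open>Finite-dimensional spaces with bases\<close>

definition fun_subspace :: "('x \<Rightarrow> 'b::real_vector) set \<Rightarrow> bool" where
  "fun_subspace V \<longleftrightarrow> (\<lambda>x. 0) \<in> V
     \<and> (\<forall>u\<in>V. \<forall>v\<in>V. (\<lambda>x. u x + v x) \<in> V) \<and> (\<forall>a. \<forall>u\<in>V. (\<lambda>x. a *\<^sub>R u x) \<in> V)"

text \<open>\<open>b 0, \<dots>, b (n - 1)\<close> is a basis of the subspace \<open>V\<close>, functions being identified if
  they agree almost everywhere on \<open>\<Omega>\<close>; hence $\dim V = n$.\<close>

definition has_basis ::
  "(real ^ 'd) set \<Rightarrow> (real ^ 'd \<Rightarrow> 'b::real_vector) set \<Rightarrow> nat \<Rightarrow> (nat \<Rightarrow> real ^ 'd \<Rightarrow> 'b) \<Rightarrow> bool"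
where
  "has_basis \<Omega> V n b \<longleftrightarrow> fun_subspace V \<and> (\<forall>i<n. b i \<in> V)
     \<and> (\<forall>c. (AE x in lebesgue_on \<Omega>. (\<Sum>i<n. c i *\<^sub>R b i x) = 0) \<longrightarrow> (\<forall>i<n. c i = 0))
     \<and> (\<forall>v\<in>V. \<exists>c. AE x in lebesgue_on \<Omega>. v x = (\<Sum>i<n. c i *\<^sub>R b i x))"

section \<open>Bilinear forms and their matrices\<close>

definition sym_grad ::
  "(real ^ 'd) set \<Rightarrow> (real ^ 'd \<Rightarrow> real ^ 'd) \<Rightarrow> 'd \<Rightarrow> 'd \<Rightarrow> real ^ 'd \<Rightarrow> real" where
  "sym_grad \<Omega> u i j x =
     (weak_deriv \<Omega> j (\<lambda>y. vec_nth (u y) i) x + weak_deriv \<Omega> i (\<lambda>y. vec_nth (u y) j) x) / 2"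

definition weak_div ::
  "(real ^ 'd) set \<Rightarrow> (real ^ 'd \<Rightarrow> real ^ 'd) \<Rightarrow> real ^ 'd \<Rightarrow> real" where
  "weak_div \<Omega> u x = (\<Sum>i\<in>UNIV. weak_deriv \<Omega> i (\<lambda>y. vec_nth (u y) i) x)"

definition form_K ::
  "(real ^ 'd) set \<Rightarrow> (real ^ 'd \<Rightarrow> real ^ 'd) \<Rightarrow> (real ^ 'd \<Rightarrow> real ^ 'd) \<Rightarrow> real" where
  "form_K \<Omega> u v =
     (LINT x|lebesgue_on \<Omega>. (\<Sum>i\<in>UNIV. \<Sum>j\<in>UNIV. sym_grad \<Omega> u i j x * sym_grad \<Omega> v i j x))
     - (LINT x|lebesgue_on \<Omega>. 1 / 3 * (weak_div \<Omega> u x * weak_div \<Omega> v x))"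

definition form_G ::
  "(real ^ 'd) set \<Rightarrow> (real ^ 'd \<Rightarrow> real) \<Rightarrow> (real ^ 'd \<Rightarrow> real ^ 'd) \<Rightarrow> real" where
  "form_G \<Omega> q v = - (LINT x|lebesgue_on \<Omega>. q x * weak_div \<Omega> v x)"

definition form_C ::
  "(real ^ 'd) set \<Rightarrow> (real ^ 'd \<Rightarrow> real) \<Rightarrow> (real ^ 'd \<Rightarrow> real) \<Rightarrow> real" where
  "form_C \<Omega> p q = (LINT x|lebesgue_on \<Omega>. (\<Sum>i\<in>UNIV. weak_deriv \<Omega> i p x * weak_deriv \<Omega> i q x))"

definition form_Q ::
  "(real ^ 'd) set \<Rightarrow> (real ^ 'd \<Rightarrow> real) \<Rightarrow> (real ^ 'd \<Rightarrow> real) \<Rightarrow> real" where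
  "form_Q \<Omega> p q = (LINT x|lebesgue_on \<Omega>. p x * q x)"

text \<open>Rows belong to the first argument of the form, columns to the second.\<close>

definition form_mat ::
  "('u \<Rightarrow> 'v \<Rightarrow> real) \<Rightarrow> nat \<Rightarrow> (nat \<Rightarrow> 'u) \<Rightarrow> nat \<Rightarrow> (nat \<Rightarrow> 'v) \<Rightarrow> real mat" where
  "form_mat B m a n b = Matrix.mat m n (\<lambda>(i, j). B (a i) (b j))"

section \<open>Definite matrices\<close>

definition quad :: "real mat \<Rightarrow> real Matrix.vec \<Rightarrow> real" where
  "quad A x = (A *\<^sub>v x) \<bullet> x"

definition sym_mat :: "nat \<Rightarrow> real mat \<Rightarrow> bool" where
  "sym_mat n A \<longleftrightarrow> A \<in> carrier_mat n n \<and> transpose_mat A = A"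

definition pos_def :: "nat \<Rightarrow> real mat \<Rightarrow> bool" where
  "pos_def n A \<longleftrightarrow> sym_mat n A \<and> (\<forall>x\<in>carrier_vec n. x \<noteq> 0\<^sub>v n \<longrightarrow> quad A x > 0)"

definition neg_def :: "nat \<Rightarrow> real mat \<Rightarrow> bool" where
  "neg_def n A \<longleftrightarrow> sym_mat n A \<and> (\<forall>x\<in>carrier_vec n. x \<noteq> 0\<^sub>v n \<longrightarrow> quad A x < 0)"

definition pos_semidef :: "nat \<Rightarrow> real mat \<Rightarrow> bool" where
  "pos_semidef n A \<longleftrightarrow> sym_mat n A \<and> (\<forall>x\<in>carrier_vec n. quad A x \<ge> 0)"

definition loewner_le :: "nat \<Rightarrow> real mat \<Rightarrow> real mat \<Rightarrow> bool" where
  "loewner_le n A B \<longleftrightarrow> A \<in> carrier_mat n n \<and> B \<in> carrier_mat n n \<and> pos_semidef n (B - A)"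

text \<open>The bounds are not required to be attained; \<open>quad B q\<close> is nonzero whenever \<open>B\<close> is
  positive or negative definite.\<close>

definition quotient_bounds :: "nat \<Rightarrow> real mat \<Rightarrow> real mat \<Rightarrow> real \<Rightarrow> real \<Rightarrow> bool" where
  "quotient_bounds n A B lo up \<longleftrightarrow>
     (\<forall>q\<in>carrier_vec n. q \<noteq> 0\<^sub>v n \<longrightarrow> lo \<le> quad A q / quad B q \<and> quad A q / quad B q \<le> up)"

abbreviation inv_mat :: "real mat \<Rightarrow> real mat" where
  "inv_mat A \<equiv> the (mat_inverse A)"

section \<open>The block matrices\<close>

text \<open>The \<open>3 \<times> 3\<close> block matrix with the given blocks, listed row by row; the
  double transpose places \<open>A31\<close> and \<open>A32\<close> side by side.\<close>

definition block3 ::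
  "real mat \<Rightarrow> real mat \<Rightarrow> real mat \<Rightarrow> real mat \<Rightarrow> real mat \<Rightarrow> real mat \<Rightarrow>
   real mat \<Rightarrow> real mat \<Rightarrow> real mat \<Rightarrow> real mat" where
  "block3 A11 A12 A13 A21 A22 A23 A31 A32 A33 =
     four_block_mat
       (four_block_mat A11 A12 A21 A22)
       (A13 @\<^sub>r A23)
       (transpose_mat (transpose_mat A31 @\<^sub>r transpose_mat A32))
       A33"

definition mat_R :: "real \<Rightarrow> real \<Rightarrow> real mat \<Rightarrow> real mat \<Rightarrow> real mat" where
  "mat_R \<eta> k C Q = (- inverse \<eta>) \<cdot>\<^sub>m Q - k \<cdot>\<^sub>m C"

definition mat_S :: "real \<Rightarrow> real \<Rightarrow> real mat \<Rightarrow> real mat" where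
  "mat_S \<eta> \<zeta> Q = (- (inverse (2 * \<eta>) + inverse \<zeta>)) \<cdot>\<^sub>m Q"

definition block_A ::
  "nat \<Rightarrow> real \<Rightarrow> real \<Rightarrow> real \<Rightarrow> real mat \<Rightarrow> real mat \<Rightarrow> real mat \<Rightarrow> real mat \<Rightarrow> real mat" where
  "block_A np \<eta> \<zeta> k K G C Q =
     block3 (\<eta> \<cdot>\<^sub>m K) (transpose_mat G) (transpose_mat G)
            G        ((- k) \<cdot>\<^sub>m C)    (0\<^sub>m np np)
            G        (0\<^sub>m np np)      ((- inverse \<zeta>) \<cdot>\<^sub>m Q)"

text \<open>In the next two definitions \<open>K'\<close>, \<open>R'\<close>, \<open>S'\<close> are the preconditioning blocks
  $\mathcal{K}$, $\mathcal{R}$, $\mathcal{S}$.\<close>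

definition block_P ::
  "nat \<Rightarrow> nat \<Rightarrow> real \<Rightarrow> real mat \<Rightarrow> real mat \<Rightarrow> real mat \<Rightarrow> real mat \<Rightarrow> real mat" where
  "block_P nu np \<eta> G K' R' S' =
     block3 (\<eta> \<cdot>\<^sub>m K') (0\<^sub>m nu np) (0\<^sub>m nu np)
            G         R'          (0\<^sub>m np np)
            G         (0\<^sub>m np np) S'"

definition block_H ::
  "nat \<Rightarrow> nat \<Rightarrow> real \<Rightarrow> real mat \<Rightarrow> real mat \<Rightarrow> real mat \<Rightarrow> real mat \<Rightarrow> real mat" where
  "block_H nu np \<eta> K K' R' S' =
     block3 (\<eta> \<cdot>\<^sub>m (K - K')) (0\<^sub>m nu np) (0\<^sub>m nu np)
            (0\<^sub>m np nu)      (- R')      (0\<^sub>m np np)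
            (0\<^sub>m np nu)      (0\<^sub>m np np) (- S')"

end

theory Submission
  imports Defs
begin

text \<open>
  Write \<open>x = (u, p, q)\<close>, \<open>D = K - K'\<close> (positive definite since \<open>c\<^sub>k > 1\<close>) and
  \<open>w = K'\<^sup>-\<^sup>1 (D u + \<eta>\<^sup>-\<^sup>1 G\<^sup>T (p + q))\<close>. Block elimination shows that \<open>H P\<^sup>-\<^sup>1 A\<close> is the
  symmetric form with
  \<open>\<langle>H P\<^sup>-\<^sup>1 A x, x\<rangle> = \<eta> \<langle>D u, u\<rangle> + \<eta> \<langle>K' w, w\<rangle> + k \<langle>C p, p\<rangle> + \<zeta>\<^sup>-\<^sup>1 \<langle>Q q, q\<rangle>\<close>.
  It misses only \<open>\<langle>Q p, p\<rangle>\<close> when compared with \<open>\<langle>H x, x\<rangle>\<close>. That term is recovered from the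
  inf-sup condition: \<open>G\<^sup>T (p + q) = \<eta> (K' w - D u)\<close>, and since \<open>D + K' = K\<close>, Young's inequality
  gives \<open>\<langle>K\<^sup>-\<^sup>1 G\<^sup>T (p + q), G\<^sup>T (p + q)\<rangle> \<le> 2 \<eta>\<^sup>2 (\<langle>D u, u\<rangle> + \<langle>K' w, w\<rangle>)\<close>. The upper bound
  estimates \<open>\<langle>K' w, w\<rangle>\<close> in the same way with the upper inf-sup constant. The spectral
  inclusion follows because \<open>P\<^sup>-\<^sup>1 A\<close> is self-adjoint in the inner product of \<open>H\<close>.
\<close>

section \<open>The bilinear form of a matrix\<close>

text \<open>The polarisation of \<open>quad\<close>, allowing rectangular matrices: in
  \<open>bil G u p\<close> the velocity comes first and the pressure second. Block identities can
  then be checked by testing with vectors, without multiplying matrices out.\<close>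

definition bil :: "real mat \<Rightarrow> real Matrix.vec \<Rightarrow> real Matrix.vec \<Rightarrow> real" where
  "bil A x y = (A *\<^sub>v x) \<bullet> y"

lemma quad_eq_bil: "quad A x = bil A x x"
  by (simp add: quad_def bil_def)

text \<open>Here and below the side conditions are equations between dimensions rather than carrier
  memberships, so that the simplifier can discharge them.\<close>

lemma bil_add_left:
  assumes "dim_vec x = dim_col A" "dim_vec y = dim_col A" "dim_vec z = dim_row A"
  shows "bil A (x + y) z = bil A x z + bil A y z"
proof -
  define nr nc where "nr = dim_row A" "nc = dim_col A"
  have c: "A \<in> carrier_mat nr nc" "x \<in> carrier_vec nc" "y \<in> carrier_vec nc" "z \<in> carrier_vec nr"
    using assms unfolding nr_nc_def carrier_mat_def carrier_vec_def by simp_all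
  show ?thesis
    unfolding bil_def mult_add_distrib_mat_vec[OF c(1-3)]
    by (rule add_scalar_prod_distrib) (use c in auto)
qed

lemma bil_diff_left:
  assumes "dim_vec x = dim_col A" "dim_vec y = dim_col A" "dim_vec z = dim_row A"
  shows "bil A (x - y) z = bil A x z - bil A y z"
proof -
  define nr nc where "nr = dim_row A" "nc = dim_col A"
  have c: "A \<in> carrier_mat nr nc" "x \<in> carrier_vec nc" "y \<in> carrier_vec nc" "z \<in> carrier_vec nr"
    using assms unfolding nr_nc_def carrier_mat_def carrier_vec_def by simp_all
  show ?thesis
    unfolding bil_def mult_minus_distrib_mat_vec[OF c(1-3)]
    by (rule minus_scalar_prod_distrib) (use c in auto)
qed

lemma bil_smult_left:
  assumes "dim_vec x = dim_col A" "dim_vec y = dim_row A"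
  shows "bil A (a \<cdot>\<^sub>v x) y = a * bil A x y"
proof -
  define nr nc where "nr = dim_row A" "nc = dim_col A"
  have c: "A \<in> carrier_mat nr nc" "x \<in> carrier_vec nc" "y \<in> carrier_vec nr"
    using assms unfolding nr_nc_def carrier_mat_def carrier_vec_def by simp_all
  show ?thesis
    unfolding bil_def mult_mat_vec[OF c(1,2)]
    by (rule smult_scalar_prod_distrib) (use c in auto)
qed

lemma bil_transpose:
  assumes "dim_vec x = dim_row A" "dim_vec y = dim_col A"
  shows "bil (transpose_mat A) x y = bil A y x"
proof -
  define nr nc where "nr = dim_row A" "nc = dim_col A"
  have c: "A \<in> carrier_mat nr nc" "y \<in> carrier_vec nc" "x \<in> carrier_vec nr"
    using assms unfolding nr_nc_def carrier_mat_def carrier_vec_def by simp_all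
  show ?thesis
    unfolding bil_def transpose_vec_mult_scalar[OF c]
    by (rule comm_scalar_prod) (use c in auto)
qed

lemma bil_add_right:
  assumes "dim_vec x = dim_col A" "dim_vec y = dim_row A" "dim_vec z = dim_row A"
  shows "bil A x (y + z) = bil A x y + bil A x z"
  using assms bil_add_left[of y "transpose_mat A" z x] by (simp add: bil_transpose)

lemma bil_diff_right:
  assumes "dim_vec x = dim_col A" "dim_vec y = dim_row A" "dim_vec z = dim_row A"
  shows "bil A x (y - z) = bil A x y - bil A x z"
  using assms bil_diff_left[of y "transpose_mat A" z x] by (simp add: bil_transpose)

lemma bil_smult_right:
  assumes "dim_vec x = dim_col A" "dim_vec y = dim_row A"
  shows "bil A x (a \<cdot>\<^sub>v y) = a * bil A x y"
  using assms bil_smult_left[of y "transpose_mat A" x] by (simp add: bil_transpose)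

lemmas bil_linear = bil_add_left bil_diff_left bil_smult_left
  bil_add_right bil_diff_right bil_smult_right

lemma bil_zero_left [simp]:
  assumes "dim_col A = n" "dim_vec y = dim_row A"
  shows "bil A (0\<^sub>v n) y = 0"
  using assms bil_diff_left[of "0\<^sub>v n" A "0\<^sub>v n" y] by simp

lemma bil_zero_right [simp]:
  assumes "dim_row A = n" "dim_vec x = dim_col A"
  shows "bil A x (0\<^sub>v n) = 0"
  using assms bil_diff_right[of x A "0\<^sub>v n" "0\<^sub>v n"] by simp

lemma bil_smult_mat:
  assumes "dim_vec x = dim_col A" "dim_vec y = dim_row A"
  shows "bil (a \<cdot>\<^sub>m A) x y = a * bil A x y"
proof -
  have "(a \<cdot>\<^sub>m A) *\<^sub>v x = A *\<^sub>v (a \<cdot>\<^sub>v x)"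
    using assms by (intro eq_vecI) (auto simp: scalar_prod_def algebra_simps)
  then have "bil (a \<cdot>\<^sub>m A) x y = bil A (a \<cdot>\<^sub>v x) y"
    by (simp add: bil_def)
  with assms show ?thesis
    by (simp add: bil_smult_left)
qed

lemma bil_minus_mat:
  assumes "dim_row B = dim_row A" "dim_col B = dim_col A"
    "dim_vec x = dim_col A" "dim_vec y = dim_row A"
  shows "bil (A - B) x y = bil A x y - bil B x y"
proof -
  define nr nc where "nr = dim_row A" "nc = dim_col A"
  have c: "A \<in> carrier_mat nr nc" "B \<in> carrier_mat nr nc" "x \<in> carrier_vec nc" "y \<in> carrier_vec nr"
    using assms unfolding nr_nc_def carrier_mat_def carrier_vec_def by simp_all
  show ?thesis
    unfolding bil_def minus_mult_distrib_mat_vec[OF c(1-3)]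
    by (rule minus_scalar_prod_distrib) (use c in auto)
qed

lemma bil_uminus_mat:
  assumes "dim_vec x = dim_col A" "dim_vec y = dim_row A"
  shows "bil (- A) x y = - bil A x y"
  unfolding bil_def using assms by simp

lemma bil_zero_mat:
  assumes "dim_vec x = nc" "dim_vec y = nr"
  shows "bil (0\<^sub>m nr nc) x y = 0"
  using assms by (auto simp: bil_def scalar_prod_def intro!: sum.neutral)

lemma bil_times_mat:
  assumes "dim_row B = dim_col A" "dim_vec x = dim_col B"
  shows "bil (A * B) x y = bil A (B *\<^sub>v x) y"
proof -
  define nr nc nb where "nr = dim_row A" "nc = dim_col A" "nb = dim_col B"
  have c: "A \<in> carrier_mat nr nc" "B \<in> carrier_mat nc nb" "x \<in> carrier_vec nb"
    using assms unfolding nr_nc_nb_def carrier_mat_def carrier_vec_def by simp_all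
  show ?thesis
    unfolding bil_def assoc_mult_mat_vec[OF c] ..
qed

section \<open>Symmetric matrices, the Loewner order and Young's inequality\<close>

lemma bil_sym:
  assumes "sym_mat n A" "dim_vec x = n" "dim_vec y = n"
  shows "bil A x y = bil A y x"
  using assms bil_transpose[of x A y] unfolding sym_mat_def by (metis carrier_matD)

text \<open>Unit vectors recover the entries from the form. This makes the symmetry of
  \<open>H * T\<close> accessible without writing down the blocks of the inverse of
  \<open>P\<close>.\<close>

lemma sym_matI_bil:
  assumes A: "A \<in> carrier_mat n n"
    and sym: "\<And>x y. x \<in> carrier_vec n \<Longrightarrow> y \<in> carrier_vec n \<Longrightarrow> bil A x y = bil A y x"
  shows "sym_mat n A"
proof -
  have entry: "bil A (unit_vec n j) (unit_vec n i) = A $$ (i, j)" if "i < n" "j < n" for i j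
    using A that by (simp add: bil_def)
  have "A $$ (i, j) = A $$ (j, i)" if "i < n" "j < n" for i j
    using sym[of "unit_vec n j" "unit_vec n i"] entry[of i j] entry[of j i] that by simp
  then have "transpose_mat A = A"
    using A by (intro eq_matI) auto
  with A show ?thesis by (simp add: sym_mat_def)
qed

lemma sym_mat_diff:
  assumes "sym_mat n A" "sym_mat n B"
  shows "sym_mat n (A - B)"
proof (rule sym_matI_bil)
  show "A - B \<in> carrier_mat n n"
    using assms by (auto simp: sym_mat_def)
  fix x y :: "real Matrix.vec"
  assume xy: "x \<in> carrier_vec n" "y \<in> carrier_vec n"
  have "bil A x y = bil A y x" "bil B x y = bil B y x"
    using assms xy by (auto intro: bil_sym)
  then show "bil (A - B) x y = bil (A - B) y x"
    using assms xy by (auto simp: sym_mat_def bil_minus_mat)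
qed

lemma sym_mat_smult:
  assumes "sym_mat n A"
  shows "sym_mat n (a \<cdot>\<^sub>m A)"
proof (rule sym_matI_bil)
  show "a \<cdot>\<^sub>m A \<in> carrier_mat n n"
    using assms by (auto simp: sym_mat_def)
  fix x y :: "real Matrix.vec"
  assume "x \<in> carrier_vec n" "y \<in> carrier_vec n"
  then show "bil (a \<cdot>\<^sub>m A) x y = bil (a \<cdot>\<^sub>m A) y x"
    using assms bil_sym[OF assms, of x y] by (auto simp: sym_mat_def bil_smult_mat)
qed

lemma pos_def_imp_semidef: "pos_def n A \<Longrightarrow> pos_semidef n A"
  unfolding pos_def_def pos_semidef_def quad_eq_bil sym_mat_def
  by (metis bil_zero_left carrier_matD carrier_vecD order.order_iff_strict)

lemma loewner_leI:
  assumes "sym_mat n A" "sym_mat n B"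
    and "\<And>x. x \<in> carrier_vec n \<Longrightarrow> quad A x \<le> quad B x"
  shows "loewner_le n A B"
proof -
  have "A \<in> carrier_mat n n" "B \<in> carrier_mat n n"
    using assms by (auto simp: sym_mat_def)
  then show ?thesis
    using assms sym_mat_diff[OF assms(2,1)]
    by (auto simp: loewner_le_def pos_semidef_def quad_eq_bil bil_minus_mat)
qed

text \<open>Expand the nonnegative value of \<open>quad A\<close> at \<open>2 a x - y\<close> and
  divide by \<open>4 a\<close>. The weight \<open>a\<close> stays free so that later one of the two
  terms can be absorbed into a left-hand side.\<close>

lemma bil_Young:
  assumes A: "pos_semidef n A" and x: "x \<in> carrier_vec n" and y: "y \<in> carrier_vec n"
    and a: "0 < a"
  shows "bil A x y \<le> a * quad A x + quad A y / (4 * a)"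
proof -
  have dims: "dim_row A = n" "dim_col A = n" "dim_vec x = n" "dim_vec y = n"
    using A x y by (auto simp: pos_semidef_def sym_mat_def)
  have "0 \<le> quad A ((2 * a) \<cdot>\<^sub>v x - y)"
    using A x y by (auto simp: pos_semidef_def)
  also have "\<dots> = 4 * a * (a * quad A x + quad A y / (4 * a) - bil A x y)"
    using A a dims bil_sym[of n A x y]
    by (simp add: quad_eq_bil bil_linear pos_semidef_def field_simps)
  finally show ?thesis
    using a by (simp add: zero_le_mult_iff)
qed

lemma bil_Young_neg:
  assumes A: "pos_semidef n A" and x: "x \<in> carrier_vec n" and y: "y \<in> carrier_vec n"
    and a: "0 < a"
  shows "- bil A x y \<le> a * quad A x + quad A y / (4 * a)"
proof -
  have "dim_row A = n" "dim_col A = n" "dim_vec x = n" "dim_vec y = n"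
    using A x y by (auto simp: pos_semidef_def sym_mat_def)
  then show ?thesis
    using bil_Young[OF A _ y a, of "(-1) \<cdot>\<^sub>v x"] x
    by (simp add: quad_eq_bil bil_smult_left bil_smult_right)
qed

section \<open>Existence of inverses, and quotient bounds in product form\<close>

text \<open>\<open>inv_mat\<close> applies \<open>the\<close> to an option, so
  \<open>mat_inverse\<close> must first be shown to succeed. A trivial kernel gives a nonzero
  determinant and hence a unit of the matrix ring. Symmetry is not assumed, because \<open>P\<close>
  is block triangular.\<close>

lemma inv_mat_if_trivial_kernel:
  assumes A: "A \<in> carrier_mat n n"
    and ker: "\<And>x. x \<in> carrier_vec n \<Longrightarrow> A *\<^sub>v x = 0\<^sub>v n \<Longrightarrow> x = 0\<^sub>v n"
  shows "inv_mat A \<in> carrier_mat n n" "A * inv_mat A = 1\<^sub>m n"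
proof -
  have "Determinant.det A \<noteq> 0"
    using det_0_iff_vec_prod_zero_field[OF A] ker by blast
  \<comment> \<open>\<open>undefined\<close> only fills the extension slot of the ring record; the
    same value is used for \<open>mat_inverse\<close> below.\<close>
  then have "A \<in> Units (ring_mat TYPE(real) n undefined)"
    by (rule det_non_zero_imp_unit[OF A])
  then obtain B where "mat_inverse A = Some B"
    using mat_inverse(1)[OF A, of undefined] by fastforce
  with mat_inverse(2)[OF A this]
  show "inv_mat A \<in> carrier_mat n n" "A * inv_mat A = 1\<^sub>m n"
    by auto
qed

lemma pos_def_inv_mat:
  assumes "pos_def n A"
  shows "inv_mat A \<in> carrier_mat n n" "A * inv_mat A = 1\<^sub>m n"
proof -
  have A: "A \<in> carrier_mat n n"
    using assms by (simp add: pos_def_def sym_mat_def)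
  have ker: "x = 0\<^sub>v n" if "x \<in> carrier_vec n" "A *\<^sub>v x = 0\<^sub>v n" for x
  proof (rule ccontr)
    assume "x \<noteq> 0\<^sub>v n"
    with assms that have "quad A x > 0"
      by (simp add: pos_def_def)
    with that show False by (simp add: quad_def)
  qed
  show "inv_mat A \<in> carrier_mat n n" "A * inv_mat A = 1\<^sub>m n"
    using inv_mat_if_trivial_kernel[OF A ker] by blast+
qed

lemma quad_eq_0_imp_zero:
  assumes "pos_def n A \<or> neg_def n A" "x \<in> carrier_vec n" "quad A x = 0"
  shows "x = 0\<^sub>v n"
  using assms unfolding pos_def_def neg_def_def by force

text \<open>Clears the positive denominator. The zero vector, which \<open>quotient_bounds\<close>
  leaves out, makes both quadratic forms vanish.\<close>

lemma quotient_bounds_pos_def: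
  assumes "quotient_bounds n A B lo up" "pos_def n B" "dim_row A = n" "dim_col A = n"
    and x: "x \<in> carrier_vec n"
  shows "lo * quad B x \<le> quad A x" "quad A x \<le> up * quad B x"
proof -
  have "lo * quad B x \<le> quad A x \<and> quad A x \<le> up * quad B x"
  proof (cases "x = 0\<^sub>v n")
    case True
    have "dim_row B = n" "dim_col B = n"
      using assms(2) by (auto simp: pos_def_def sym_mat_def)
    then have "quad A x = 0" "quad B x = 0"
      using assms(3,4) bil_zero_left[of A n x] bil_zero_left[of B n x] x True
      by (auto simp: quad_eq_bil)
    then show ?thesis by simp
  next
    case False
    then have "quad B x > 0" "lo \<le> quad A x / quad B x" "quad A x / quad B x \<le> up"
      using assms by (auto simp: pos_def_def quotient_bounds_def)
    then show ?thesis by (simp add: field_simps)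
  qed
  then show "lo * quad B x \<le> quad A x" "quad A x \<le> up * quad B x" by auto
qed

text \<open>Negating both matrices leaves the quotient unchanged and makes the denominator
  positive.\<close>

lemma quotient_bounds_neg_def:
  assumes "quotient_bounds n A B lo up" "neg_def n B" "dim_row A = n" "dim_col A = n"
    and x: "x \<in> carrier_vec n"
  shows "lo * - quad B x \<le> - quad A x" "- quad A x \<le> up * - quad B x"
proof -
  have B: "sym_mat n B" "dim_row B = n" "dim_col B = n"
    using assms(2) by (auto simp: neg_def_def sym_mat_def)
  have neg: "quad (- A) y = - quad A y" "quad (- B) y = - quad B y" if "y \<in> carrier_vec n" for y
    using B assms(3,4) that by (auto simp: quad_eq_bil bil_uminus_mat)
  have "sym_mat n (- B)"
    using B by (simp add: sym_mat_def transpose_uminus)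
  then have "pos_def n (- B)"
    using assms(2) neg by (auto simp: pos_def_def neg_def_def)
  moreover have "quotient_bounds n (- A) (- B) lo up"
    using assms(1) neg by (auto simp: quotient_bounds_def)
  ultimately show "lo * - quad B x \<le> - quad A x" "- quad A x \<le> up * - quad B x"
    using quotient_bounds_pos_def[of n "- A" "- B" lo up x] assms(3,4) x neg by auto
qed

section \<open>Block matrices evaluated on block vectors\<close>

lemma block3_carrier:
  assumes "A11 \<in> carrier_mat n n" "A12 \<in> carrier_mat n m" "A13 \<in> carrier_mat n l"
    "A21 \<in> carrier_mat m n" "A22 \<in> carrier_mat m m" "A23 \<in> carrier_mat m l"
    "A31 \<in> carrier_mat l n" "A32 \<in> carrier_mat l m" "A33 \<in> carrier_mat l l"
  shows "block3 A11 A12 A13 A21 A22 A23 A31 A32 A33 \<in> carrier_mat (n + m + l) (n + m + l)"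
  unfolding block3_def using assms by auto

lemma bil_four_block:
  assumes "A \<in> carrier_mat nr1 nc1" "B \<in> carrier_mat nr1 nc2"
    "C \<in> carrier_mat nr2 nc1" "D \<in> carrier_mat nr2 nc2"
    "x \<in> carrier_vec nc1" "y \<in> carrier_vec nc2" "x' \<in> carrier_vec nr1" "y' \<in> carrier_vec nr2"
  shows "bil (four_block_mat A B C D) (x @\<^sub>v y) (x' @\<^sub>v y') =
    bil A x x' + bil B y x' + bil C x y' + bil D y y'"
  using assms
  by (simp add: bil_def four_block_mat_mult_vec[of _ nr1 nc1 _ nc2 _ nr2]
      scalar_prod_append[of _ nr1 _ nr2] add_scalar_prod_distrib[of _ nr1]
      add_scalar_prod_distrib[of _ nr2])

lemma bil_append_rows:
  assumes "A \<in> carrier_mat nr1 nc" "B \<in> carrier_mat nr2 nc"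
    "x \<in> carrier_vec nc" "x' \<in> carrier_vec nr1" "y' \<in> carrier_vec nr2"
  shows "bil (A @\<^sub>r B) x (x' @\<^sub>v y') = bil A x x' + bil B x y'"
  using assms
  by (simp add: bil_def mat_mult_append[of _ nr1 nc _ nr2] scalar_prod_append[of _ nr1 _ nr2])

lemma bil_block3:
  assumes A: "A11 \<in> carrier_mat n n" "A12 \<in> carrier_mat n m" "A13 \<in> carrier_mat n l"
    "A21 \<in> carrier_mat m n" "A22 \<in> carrier_mat m m" "A23 \<in> carrier_mat m l"
    "A31 \<in> carrier_mat l n" "A32 \<in> carrier_mat l m" "A33 \<in> carrier_mat l l"
    and x: "u \<in> carrier_vec n" "p \<in> carrier_vec m" "q \<in> carrier_vec l"
      "u' \<in> carrier_vec n" "p' \<in> carrier_vec m" "q' \<in> carrier_vec l"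
  shows "bil (block3 A11 A12 A13 A21 A22 A23 A31 A32 A33)
      ((u @\<^sub>v p) @\<^sub>v q) ((u' @\<^sub>v p') @\<^sub>v q') =
    bil A11 u u' + bil A12 p u' + bil A13 q u' +
    bil A21 u p' + bil A22 p p' + bil A23 q p' +
    bil A31 u q' + bil A32 p q' + bil A33 q q'"
proof -
  let ?low = "transpose_mat A31 @\<^sub>r transpose_mat A32"
  have low: "?low \<in> carrier_mat (n + m) l"
    using A by auto
  \<comment> \<open>The lower left pair of blocks is encoded as the transpose of a stack; moving the
    transpose across the form lets the stack be split by rows.\<close>
  have "bil (transpose_mat ?low) (u @\<^sub>v p) q' = bil ?low q' (u @\<^sub>v p)"
    using carrier_matD[OF low] x by (intro bil_transpose) auto
  also have "\<dots> = bil (transpose_mat A31) q' u + bil (transpose_mat A32) q' p"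
    using A x by (intro bil_append_rows) auto
  also have "\<dots> = bil A31 u q' + bil A32 p q'"
    using A x by (simp add: bil_transpose)
  finally have "bil (transpose_mat ?low) (u @\<^sub>v p) q' = bil A31 u q' + bil A32 p q'" .
  moreover have "bil (A13 @\<^sub>r A23) q (u' @\<^sub>v p') = bil A13 q u' + bil A23 q p'"
    using A x by (intro bil_append_rows) auto
  moreover have "bil (four_block_mat A11 A12 A21 A22) (u @\<^sub>v p) (u' @\<^sub>v p') =
      bil A11 u u' + bil A12 p u' + bil A21 u p' + bil A22 p p'"
    using A x by (intro bil_four_block) auto
  ultimately show ?thesis
    unfolding block3_def using A x low
    by (subst bil_four_block[of _ "n + m" "n + m" _ l _ l]) auto
qed

lemma append_vec3_cases:
  assumes "x \<in> carrier_vec (n + m + l)"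
  obtains u p q where "u \<in> carrier_vec n" "p \<in> carrier_vec m" "q \<in> carrier_vec l"
    "x = (u @\<^sub>v p) @\<^sub>v q"
proof -
  have "x = (vec_first (vec_first x (n + m)) n @\<^sub>v vec_last (vec_first x (n + m)) m) @\<^sub>v vec_last x l"
    using assms by simp
  with vec_first_carrier vec_last_carrier vec_last_carrier show thesis
    by (rule that)
qed

section \<open>The spectrum of an operator that is self-adjoint in a given inner product\<close>

text \<open>An operator \<open>T\<close> that is self-adjoint in the inner product of \<open>H\<close> has only real
  eigenvalues: if \<open>T (x + \<i> y) = (a + \<i> b) (x + \<i> y)\<close>, then
  \<open>\<langle>H T x, y\<rangle> = \<langle>H T y, x\<rangle>\<close> reads \<open>b (\<langle>H x, x\<rangle> + \<langle>H y, y\<rangle>) = 0\<close>.\<close>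

lemma spectrum_self_adjoint_subset:
  assumes T: "T \<in> carrier_mat n n" and H: "pos_def n H" and HT: "sym_mat n (H * T)"
    and lo: "\<And>x. x \<in> carrier_vec n \<Longrightarrow> lo * quad H x \<le> quad (H * T) x"
    and up: "\<And>x. x \<in> carrier_vec n \<Longrightarrow> quad (H * T) x \<le> up * quad H x"
  shows "spectrum (map_mat complex_of_real T) \<subseteq> complex_of_real ` {lo..up}"
proof
  fix \<mu> assume "\<mu> \<in> spectrum (map_mat complex_of_real T)"
  then obtain z where z: "z \<in> carrier_vec n" "z \<noteq> 0\<^sub>v n"
    and ev: "map_mat complex_of_real T *\<^sub>v z = \<mu> \<cdot>\<^sub>v z"
    using T by (auto simp: spectrum_def eigenvalue_def eigenvector_def)
  define x y where "x = map_vec Re z" and "y = map_vec Im z"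
  have xy: "x \<in> carrier_vec n" "y \<in> carrier_vec n"
    using z by (auto simp: x_def y_def)
  have entry: "(\<Sum>j<n. complex_of_real (T $$ (i, j)) * z $ j) = \<mu> * z $ i" if "i < n" for i
    using arg_cong[OF ev, of "\<lambda>v. v $ i"] T z(1) that
    by (simp add: scalar_prod_def atLeast0LessThan)
  \<comment> \<open>\<open>T\<close> is real, so the eigenvalue equation separates into real and
    imaginary parts.\<close>
  have Tx: "T *\<^sub>v x = Re \<mu> \<cdot>\<^sub>v x - Im \<mu> \<cdot>\<^sub>v y"
    using T z(1) arg_cong[OF entry, of _ Re]
    by (intro eq_vecI) (auto simp: x_def y_def scalar_prod_def atLeast0LessThan Re_sum)
  have Ty: "T *\<^sub>v y = Im \<mu> \<cdot>\<^sub>v x + Re \<mu> \<cdot>\<^sub>v y"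
    using T z(1) arg_cong[OF entry, of _ Im]
    by (intro eq_vecI) (auto simp: x_def y_def scalar_prod_def atLeast0LessThan Im_sum)
  have symH: "sym_mat n H"
    using H by (simp add: pos_def_def)
  have dims: "dim_row H = n" "dim_col H = n" "dim_row T = n" "dim_col T = n"
    "dim_vec x = n" "dim_vec y = n"
    using symH T xy by (auto simp: sym_mat_def)
  have nonneg: "quad H x \<ge> 0" "quad H y \<ge> 0"
    using pos_def_imp_semidef[OF H] xy by (auto simp: pos_semidef_def)
  have "x \<noteq> 0\<^sub>v n \<or> y \<noteq> 0\<^sub>v n"
  proof (rule ccontr)
    assume "\<not> ?thesis"
    then have "x $ i = 0" "y $ i = 0" if "i < n" for i
      using that by simp_all
    then have "Re (z $ i) = 0" "Im (z $ i) = 0" if "i < n" for i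
      using z(1) that unfolding x_def y_def by auto
    then have "z = 0\<^sub>v n"
      using z(1) by (intro eq_vecI) (auto simp: complex_eq_iff)
    with z show False by simp
  qed
  \<comment> \<open>Once the eigenvalue is known to be real, the nonzero part \<open>s\<close> is
    itself a real eigenvector, and comparing \<open>quad (H * T) s\<close> with
    \<open>quad H s\<close> locates the eigenvalue.\<close>
  then obtain s where s: "s = x \<or> s = y" "s \<in> carrier_vec n" "s \<noteq> 0\<^sub>v n"
    using xy by blast
  then have s_pos: "quad H s > 0"
    using H by (simp add: pos_def_def)
  have "bil (H * T) x y = bil (H * T) y x"
    by (rule bil_sym[OF HT]) (use dims in auto)
  then have "Im \<mu> * (quad H x + quad H y) = 0"
    using dims bil_sym[OF symH, of x y]
    by (simp add: bil_times_mat Tx Ty bil_linear quad_eq_bil algebra_simps)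
  moreover have "quad H x + quad H y > 0"
    using nonneg s s_pos by (auto intro: add_pos_nonneg add_nonneg_pos)
  ultimately have real: "Im \<mu> = 0" by simp
  have "quad (H * T) s = Re \<mu> * quad H s"
    using s dims by (auto simp: quad_eq_bil bil_times_mat Tx Ty real bil_linear)
  then have "lo * quad H s \<le> Re \<mu> * quad H s" "Re \<mu> * quad H s \<le> up * quad H s"
    using lo[OF s(2)] up[OF s(2)] by auto
  then have "lo \<le> Re \<mu>" "Re \<mu> \<le> up"
    using s_pos by auto
  with real show "\<mu> \<in> complex_of_real ` {lo..up}"
    by (intro image_eqI[of _ _ "Re \<mu>"]) (auto simp: complex_eq_iff)
qed


section \<open>Explicit constants and the system at a single mesh size\<close>

text \<open>The three summands under \<open>inverse\<close> bound the \<open>K - K'\<close>,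
  \<open>R'\<close> and \<open>S'\<close> parts of \<open>quad H x\<close> by multiples of the
  energy \<open>quad (H * T) x\<close>. The inner term \<open>4 * \<eta> / c_g + 2 * \<zeta>\<close>
  is the factor for \<open>quad Q p\<close>, which the energy does not contain and the inf-sup
  condition supplies.\<close>

definition lower_const :: "real \<Rightarrow> real \<Rightarrow> real \<Rightarrow> real \<Rightarrow> real \<Rightarrow> real" where
  "lower_const \<eta> \<zeta> c_g c_r c_s =
     inverse (1 + ((4 * \<eta> / c_g + 2 * \<zeta>) / \<eta> + 1) / c_r + (\<zeta> / (2 * \<eta>) + 1) / c_s)"

text \<open>The sum of the coefficients that the \<open>K - K'\<close>, \<open>R'\<close> and
  \<open>S'\<close> parts of \<open>quad H x\<close> receive in the upper estimate; a sum of
  positive numbers serves in place of their maximum. The terms with \<open>C_k\<close> come from the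
  correction \<open>w\<close>.\<close>

definition upper_const :: "real \<Rightarrow> real \<Rightarrow> real \<Rightarrow> real \<Rightarrow> real \<Rightarrow> real \<Rightarrow> real" where
  "upper_const \<eta> \<zeta> C_g C_k C_r C_s =
     1 + 2 * C_k + C_r * (1 + 4 * C_k * C_g) + C_s * (1 + 4 * C_k * C_g * \<zeta> / \<eta>)"

text \<open>The mesh size is frozen: \<open>n\<close> and \<open>m\<close> are the two dimensions at
  one \<open>h\<close>. The discretisation enters through definiteness and inf-sup inequalities, and
  bounds expressed in the constant parameters are uniform in \<open>h\<close>.\<close>

locale preconditioned_saddle_point =
  fixes n m :: nat and K G C Q K' R' S' :: "real mat"
    and \<eta> \<zeta> k c_g C_g c_k C_k c_r C_r c_s C_s :: real
  assumes G_carrier: "G \<in> carrier_mat m n"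
    and K_pd: "pos_def n K" and Q_pd: "pos_def m Q" and C_psd: "pos_semidef m C"
    and params: "0 < \<eta>" "0 < \<zeta>" "0 \<le> k"
    and inf_sup_const: "0 < c_g" "0 < C_g"
    and inf_sup: "\<And>q. q \<in> carrier_vec m \<Longrightarrow>
        c_g * quad Q q \<le> quad (G * inv_mat K * transpose_mat G) q \<and>
        quad (G * inv_mat K * transpose_mat G) q \<le> C_g * quad Q q"
    and K'_pd: "pos_def n K'" and R'_nd: "neg_def m R'" and S'_nd: "neg_def m S'"
    and precond_const: "0 < C_k" "0 < c_r" "0 < C_r" "0 < c_s" "0 < C_s"
    and bounds_K: "quotient_bounds n K K' c_k C_k"
    and bounds_R: "quotient_bounds m (mat_R \<eta> k C Q) R' c_r C_r"
    and bounds_S: "quotient_bounds m (mat_S \<eta> \<zeta> Q) S' c_s C_s"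
    and c_k_gt_1: "c_k > 1"
begin

abbreviation "N \<equiv> n + m + m"
abbreviation "A \<equiv> block_A m \<eta> \<zeta> k K G C Q"
abbreviation "P \<equiv> block_P n m \<eta> G K' R' S'"
abbreviation "H \<equiv> block_H n m \<eta> K K' R' S'"
abbreviation "T \<equiv> inv_mat P * A"

lemma carriers:
  "K \<in> carrier_mat n n" "K' \<in> carrier_mat n n" "Q \<in> carrier_mat m m" "C \<in> carrier_mat m m"
  "R' \<in> carrier_mat m m" "S' \<in> carrier_mat m m" "G \<in> carrier_mat m n"
  using K_pd Q_pd C_psd K'_pd R'_nd S'_nd G_carrier
  by (simp_all add: pos_def_def neg_def_def pos_semidef_def sym_mat_def)

lemmas dims [simp] = carriers[THEN carrier_matD(1)] carriers[THEN carrier_matD(2)]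

lemma symmetric:
  "sym_mat n K" "sym_mat n K'" "sym_mat m Q" "sym_mat m C" "sym_mat m R'" "sym_mat m S'"
  using K_pd Q_pd C_psd K'_pd R'_nd S'_nd
  by (simp_all add: pos_def_def neg_def_def pos_semidef_def)

lemma A_carrier: "A \<in> carrier_mat N N"
  unfolding block_A_def
  by (intro block3_carrier smult_carrier_mat zero_carrier_mat carriers)
    (simp_all add: carriers)

lemma P_carrier: "P \<in> carrier_mat N N"
  unfolding block_P_def
  by (intro block3_carrier smult_carrier_mat zero_carrier_mat carriers)

lemma H_carrier: "H \<in> carrier_mat N N"
  unfolding block_H_def
  by (intro block3_carrier smult_carrier_mat minus_carrier_mat uminus_carrier_mat
      zero_carrier_mat carriers)

lemma bil_A:
  assumes "u \<in> carrier_vec n" "p \<in> carrier_vec m" "q \<in> carrier_vec m"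
    "u' \<in> carrier_vec n" "p' \<in> carrier_vec m" "q' \<in> carrier_vec m"
  shows "bil A ((u @\<^sub>v p) @\<^sub>v q) ((u' @\<^sub>v p') @\<^sub>v q') =
    \<eta> * bil K u u' + bil G u' p + bil G u' q + bil G u p' - k * bil C p p'
    + bil G u q' - inverse \<zeta> * bil Q q q'"
  unfolding block_A_def using assms carriers
  by (subst bil_block3[of _ n _ m _ m]) (auto simp: bil_smult_mat bil_transpose bil_zero_mat)

lemma bil_P:
  assumes "u \<in> carrier_vec n" "p \<in> carrier_vec m" "q \<in> carrier_vec m"
    "u' \<in> carrier_vec n" "p' \<in> carrier_vec m" "q' \<in> carrier_vec m"
  shows "bil P ((u @\<^sub>v p) @\<^sub>v q) ((u' @\<^sub>v p') @\<^sub>v q') =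
    \<eta> * bil K' u u' + bil G u p' + bil R' p p' + bil G u q' + bil S' q q'"
  unfolding block_P_def using assms carriers
  by (subst bil_block3[of _ n _ m _ m]) (auto simp: bil_smult_mat bil_zero_mat)

lemma bil_H:
  assumes "u \<in> carrier_vec n" "p \<in> carrier_vec m" "q \<in> carrier_vec m"
    "u' \<in> carrier_vec n" "p' \<in> carrier_vec m" "q' \<in> carrier_vec m"
  shows "bil H ((u @\<^sub>v p) @\<^sub>v q) ((u' @\<^sub>v p') @\<^sub>v q') =
    \<eta> * bil (K - K') u u' - bil R' p p' - bil S' q q'"
proof -
  have c: "\<eta> \<cdot>\<^sub>m (K - K') \<in> carrier_mat n n" "- R' \<in> carrier_mat m m" "- S' \<in> carrier_mat m m"
    by (intro smult_carrier_mat minus_carrier_mat uminus_carrier_mat carriers)+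
  show ?thesis
    unfolding block_H_def bil_block3[OF c(1) zero_carrier_mat zero_carrier_mat zero_carrier_mat c(2)
      zero_carrier_mat zero_carrier_mat zero_carrier_mat c(3) assms]
    using assms by (simp add: bil_smult_mat bil_zero_mat bil_uminus_mat)
qed

section \<open>Definiteness of the diagonal blocks and of \<open>H\<close>\<close>

text \<open>This is the role of \<open>c_k > 1\<close>: on nonzero vectors \<open>quad K\<close> is
  at least \<open>c_k\<close> times \<open>quad K'\<close>, hence strictly larger than
  \<open>quad K'\<close>.\<close>

lemma diff_pos_def: "pos_def n (K - K')"
  unfolding pos_def_def
proof (intro conjI ballI impI)
  show "sym_mat n (K - K')"
    by (intro sym_mat_diff symmetric)
  fix x :: "real Matrix.vec" assume x: "x \<in> carrier_vec n" "x \<noteq> 0\<^sub>v n"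
  then have "quad K' x > 0"
    using K'_pd by (simp add: pos_def_def)
  then have "1 * quad K' x < c_k * quad K' x"
    using c_k_gt_1 by (intro mult_strict_right_mono) auto
  also have "\<dots> \<le> quad K x"
    using quotient_bounds_pos_def(1)[OF bounds_K K'_pd] x by simp
  finally show "quad (K - K') x > 0"
    using x by (simp add: quad_eq_bil bil_minus_mat)
qed

lemma quad_nonneg:
  "u \<in> carrier_vec n \<Longrightarrow> 0 \<le> quad K u" "u \<in> carrier_vec n \<Longrightarrow> 0 \<le> quad K' u"
  "u \<in> carrier_vec n \<Longrightarrow> 0 \<le> quad (K - K') u"
  "p \<in> carrier_vec m \<Longrightarrow> 0 \<le> quad Q p" "p \<in> carrier_vec m \<Longrightarrow> 0 \<le> quad C p"
  using K_pd K'_pd diff_pos_def Q_pd C_psd pos_def_imp_semidef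
  unfolding pos_semidef_def by blast+

lemma quad_K_split:
  assumes "u \<in> carrier_vec n"
  shows "quad K u = quad (K - K') u + quad K' u"
  using assms by (simp add: quad_eq_bil bil_minus_mat)

lemma bounds_R_quad:
  assumes p: "p \<in> carrier_vec m"
  shows "c_r * - quad R' p \<le> quad Q p / \<eta> + k * quad C p"
    "quad Q p / \<eta> + k * quad C p \<le> C_r * - quad R' p"
proof -
  have "- quad (mat_R \<eta> k C Q) p = quad Q p / \<eta> + k * quad C p"
    using p unfolding mat_R_def
    by (simp add: quad_eq_bil bil_minus_mat bil_smult_mat field_simps)
  with quotient_bounds_neg_def[OF bounds_R R'_nd _ _ p]
  show "c_r * - quad R' p \<le> quad Q p / \<eta> + k * quad C p"
    "quad Q p / \<eta> + k * quad C p \<le> C_r * - quad R' p"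
    by (simp_all add: mat_R_def)
qed

lemma bounds_S_quad:
  assumes q: "q \<in> carrier_vec m"
  shows "c_s * - quad S' q \<le> (1 / (2 * \<eta>) + 1 / \<zeta>) * quad Q q"
    "(1 / (2 * \<eta>) + 1 / \<zeta>) * quad Q q \<le> C_s * - quad S' q"
proof -
  have "- quad (mat_S \<eta> \<zeta> Q) q = (1 / (2 * \<eta>) + 1 / \<zeta>) * quad Q q"
    using q unfolding mat_S_def
    by (simp add: quad_eq_bil bil_smult_mat field_simps)
  with quotient_bounds_neg_def[OF bounds_S S'_nd _ _ q]
  show "c_s * - quad S' q \<le> (1 / (2 * \<eta>) + 1 / \<zeta>) * quad Q q"
    "(1 / (2 * \<eta>) + 1 / \<zeta>) * quad Q q \<le> C_s * - quad S' q"
    by (simp_all add: mat_S_def)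
qed

lemma H_pos_def: "pos_def N H"
  unfolding pos_def_def
proof (intro conjI ballI impI)
  show "sym_mat N H"
  proof (rule sym_matI_bil[OF H_carrier])
    fix x y :: "real Matrix.vec" assume "x \<in> carrier_vec N" "y \<in> carrier_vec N"
    then obtain u p q u' p' q' where "u \<in> carrier_vec n" "p \<in> carrier_vec m" "q \<in> carrier_vec m"
      "x = (u @\<^sub>v p) @\<^sub>v q" "u' \<in> carrier_vec n" "p' \<in> carrier_vec m" "q' \<in> carrier_vec m"
      "y = (u' @\<^sub>v p') @\<^sub>v q'"
      by (meson append_vec3_cases)
    then show "bil H x y = bil H y x"
      using bil_sym[of n "K - K'" u u'] bil_sym[of m R' p p'] bil_sym[of m S' q q']
        symmetric diff_pos_def
      by (simp add: bil_H pos_def_def)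
  qed
  fix x :: "real Matrix.vec" assume x: "x \<in> carrier_vec N" "x \<noteq> 0\<^sub>v N"
  then obtain u p q where upq: "u \<in> carrier_vec n" "p \<in> carrier_vec m" "q \<in> carrier_vec m"
    "x = (u @\<^sub>v p) @\<^sub>v q"
    by (meson append_vec3_cases)
  have H: "quad H x = \<eta> * quad (K - K') u - quad R' p - quad S' q"
    using upq by (simp add: quad_eq_bil bil_H)
  \<comment> \<open>\<open>neg_def\<close> speaks of nonzero vectors only; the upper quotient bounds
    give the signs of \<open>quad R' p\<close> and \<open>quad S' q\<close> for all \<open>p\<close>
    and \<open>q\<close> at once.\<close>
  have "0 \<le> quad Q p / \<eta> + k * quad C p" "0 \<le> (1 / (2 * \<eta>) + 1 / \<zeta>) * quad Q q"
    using quad_nonneg upq params by auto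
  then have "0 \<le> C_r * - quad R' p" "0 \<le> C_s * - quad S' q"
    using bounds_R_quad(2)[OF upq(2)] bounds_S_quad(2)[OF upq(3)] by linarith+
  then have R: "quad R' p \<le> 0" and S: "quad S' q \<le> 0"
    using precond_const by (simp_all add: zero_le_mult_iff mult_le_0_iff)
  have D: "0 \<le> \<eta> * quad (K - K') u"
    using quad_nonneg upq params by simp
  show "quad H x > 0"
  proof (rule ccontr)
    assume "\<not> ?thesis"
    with H R S D have "\<eta> * quad (K - K') u = 0" "quad R' p = 0" "quad S' q = 0"
      by linarith+
    then have "quad (K - K') u = 0" "quad R' p = 0" "quad S' q = 0"
      using params by simp_all
    then have "u = 0\<^sub>v n" "p = 0\<^sub>v m" "q = 0\<^sub>v m"
      using quad_eq_0_imp_zero[of n "K - K'" u] quad_eq_0_imp_zero[of m R' p]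
        quad_eq_0_imp_zero[of m S' q] diff_pos_def R'_nd S'_nd upq by auto
    then have "x = 0\<^sub>v N"
      using upq by (intro eq_vecI) auto
    with x show False by simp
  qed
qed

section \<open>The operator \<open>T\<close> and the symmetric form of \<open>H * T\<close>\<close>

text \<open>\<open>P\<close> is block lower triangular with definite diagonal blocks. Testing
  \<open>P x = 0\<close> with \<open>(u, 0, 0)\<close> forces \<open>u = 0\<close>, after which the
  two pressure rows decouple.\<close>

lemma inv_P: "inv_mat P \<in> carrier_mat N N" "P * inv_mat P = 1\<^sub>m N"
proof -
  have ker: "x = 0\<^sub>v N" if x: "x \<in> carrier_vec N" and Px: "P *\<^sub>v x = 0\<^sub>v N" for x
  proof -
    obtain u p q where upq: "u \<in> carrier_vec n" "p \<in> carrier_vec m" "q \<in> carrier_vec m"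
      "x = (u @\<^sub>v p) @\<^sub>v q"
      using x by (meson append_vec3_cases)
    have zero: "bil P ((u @\<^sub>v p) @\<^sub>v q) ((u' @\<^sub>v p') @\<^sub>v q') = 0"
      if "u' \<in> carrier_vec n" "p' \<in> carrier_vec m" "q' \<in> carrier_vec m" for u' p' q'
      using Px upq that by (simp add: bil_def)
    have "quad K' u = 0"
      using zero[of u "0\<^sub>v m" "0\<^sub>v m"] upq params by (simp add: bil_P quad_eq_bil)
    then have u: "u = 0\<^sub>v n"
      using quad_eq_0_imp_zero[of n K' u] K'_pd upq by simp
    have "quad R' p = 0"
      using zero[of "0\<^sub>v n" p "0\<^sub>v m"] upq by (simp add: bil_P quad_eq_bil u)
    moreover have "quad S' q = 0"
      using zero[of "0\<^sub>v n" "0\<^sub>v m" q] upq by (simp add: bil_P quad_eq_bil u)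
    ultimately have "p = 0\<^sub>v m" "q = 0\<^sub>v m"
      using quad_eq_0_imp_zero[of m R' p] quad_eq_0_imp_zero[of m S' q] R'_nd S'_nd upq by auto
    with u upq show ?thesis
      by (intro eq_vecI) auto
  qed
  show "inv_mat P \<in> carrier_mat N N" "P * inv_mat P = 1\<^sub>m N"
    using inv_mat_if_trivial_kernel[OF P_carrier ker] by blast+
qed

lemma T_carrier: "T \<in> carrier_mat N N"
  using inv_P A_carrier by simp

text \<open>Stands in for a formula for the inverse: \<open>y = T x\<close> is handled as the
  solution of \<open>P y = A x\<close>.\<close>

lemma P_T: "P * T = A"
  using inv_P A_carrier P_carrier by (simp add: assoc_mult_mat[symmetric])

text \<open>Here \<open>w = y\<^sub>1 - u\<close>, where \<open>y\<^sub>1\<close> is the first component of \<open>y = T x\<close>.\<close>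

lemma HT_correction:
  assumes upq: "u \<in> carrier_vec n" "p \<in> carrier_vec m" "q \<in> carrier_vec m"
  obtains w where "w \<in> carrier_vec n"
    "\<And>v. v \<in> carrier_vec n \<Longrightarrow> \<eta> * bil K' w v = \<eta> * bil (K - K') u v + bil G v p + bil G v q"
    "\<And>u' p' q'. u' \<in> carrier_vec n \<Longrightarrow> p' \<in> carrier_vec m \<Longrightarrow> q' \<in> carrier_vec m \<Longrightarrow>
      bil (H * T) ((u @\<^sub>v p) @\<^sub>v q) ((u' @\<^sub>v p') @\<^sub>v q') =
        \<eta> * bil (K - K') u u' + \<eta> * bil (K - K') w u' + bil G w p' + bil G w q'
        + k * bil C p p' + bil Q q q' / \<zeta>"
proof -
  define x where "x = (u @\<^sub>v p) @\<^sub>v q"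
  have x: "x \<in> carrier_vec N"
    using upq by (simp add: x_def)
  have "T *\<^sub>v x \<in> carrier_vec N"
    using T_carrier x by (rule mult_mat_vec_carrier)
  then obtain y1 y2 y3 where y: "y1 \<in> carrier_vec n" "y2 \<in> carrier_vec m" "y3 \<in> carrier_vec m"
    and Tx: "T *\<^sub>v x = (y1 @\<^sub>v y2) @\<^sub>v y3"
    by (meson append_vec3_cases)
  have PT: "bil P (T *\<^sub>v x) z = bil A x z" for z
    unfolding bil_def assoc_mult_mat_vec[OF P_carrier T_carrier x, symmetric] P_T ..
  have HT: "bil (H * T) x z = bil H (T *\<^sub>v x) z" for z
    unfolding bil_def assoc_mult_mat_vec[OF H_carrier T_carrier x] ..
  \<comment> \<open>The weak form of \<open>P y = A x\<close>; zero test components extract its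
    single rows below.\<close>
  have eq: "\<eta> * bil K' y1 u' + bil G y1 p' + bil R' y2 p' + bil G y1 q' + bil S' y3 q' =
      \<eta> * bil K u u' + bil G u' p + bil G u' q + bil G u p' - k * bil C p p'
      + bil G u q' - inverse \<zeta> * bil Q q q'"
    if "u' \<in> carrier_vec n" "p' \<in> carrier_vec m" "q' \<in> carrier_vec m" for u' p' q'
    using PT[of "(u' @\<^sub>v p') @\<^sub>v q'"] that upq y unfolding Tx by (simp add: x_def bil_A bil_P)
  show thesis
  proof (rule that[of "y1 - u"])
    show "y1 - u \<in> carrier_vec n"
      using y upq by simp
    show "\<eta> * bil K' (y1 - u) v = \<eta> * bil (K - K') u v + bil G v p + bil G v q"
      if "v \<in> carrier_vec n" for v
      using eq[of v "0\<^sub>v m" "0\<^sub>v m"] that y upq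
      by (simp add: bil_linear bil_minus_mat algebra_simps)
    show "bil (H * T) ((u @\<^sub>v p) @\<^sub>v q) ((u' @\<^sub>v p') @\<^sub>v q') =
        \<eta> * bil (K - K') u u' + \<eta> * bil (K - K') (y1 - u) u' + bil G (y1 - u) p'
        + bil G (y1 - u) q' + k * bil C p p' + bil Q q q' / \<zeta>"
      if "u' \<in> carrier_vec n" "p' \<in> carrier_vec m" "q' \<in> carrier_vec m" for u' p' q'
    proof -
      \<comment> \<open>The blocks \<open>- R'\<close> and \<open>- S'\<close> of \<open>H\<close>
        meet exactly the terms \<open>R' y2\<close> and \<open>S' y3\<close> of these rows, so no
        inverse of \<open>R'\<close> or \<open>S'\<close> arises.\<close>
      have "bil G y1 p' + bil R' y2 p' = bil G u p' - k * bil C p p'"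
        using eq[of "0\<^sub>v n" p' "0\<^sub>v m"] that y upq by simp
      moreover have "bil G y1 q' + bil S' y3 q' = bil G u q' - bil Q q q' / \<zeta>"
        using eq[of "0\<^sub>v n" "0\<^sub>v m" q'] that y upq by (simp add: field_simps)
      moreover have "bil (H * T) ((u @\<^sub>v p) @\<^sub>v q) ((u' @\<^sub>v p') @\<^sub>v q') =
          \<eta> * bil (K - K') y1 u' - bil R' y2 p' - bil S' y3 q'"
        using HT that y unfolding Tx by (simp add: x_def[symmetric] bil_H)
      ultimately show ?thesis
        using that y upq by (simp add: bil_linear algebra_simps)
    qed
  qed
qed

text \<open>The terms of \<open>HT_correction\<close> that are not visibly symmetric are those with
  \<open>w\<close>. The equation for \<open>w'\<close>, tested with \<open>w\<close>, combines them
  into \<open>\<eta> * bil K' w' w\<close>, and \<open>K'\<close> is symmetric.\<close>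

lemma HT_sym: "sym_mat N (H * T)"
proof (rule sym_matI_bil)
  show "H * T \<in> carrier_mat N N"
    using H_carrier T_carrier by simp
  fix x x' :: "real Matrix.vec" assume "x \<in> carrier_vec N" "x' \<in> carrier_vec N"
  then obtain u p q u' p' q' where
    x: "u \<in> carrier_vec n" "p \<in> carrier_vec m" "q \<in> carrier_vec m" "x = (u @\<^sub>v p) @\<^sub>v q" and
    x': "u' \<in> carrier_vec n" "p' \<in> carrier_vec m" "q' \<in> carrier_vec m" "x' = (u' @\<^sub>v p') @\<^sub>v q'"
    by (meson append_vec3_cases)
  obtain w where w: "w \<in> carrier_vec n"
    and w_eq: "\<And>v. v \<in> carrier_vec n \<Longrightarrow>
      \<eta> * bil K' w v = \<eta> * bil (K - K') u v + bil G v p + bil G v q"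
    and HT: "bil (H * T) x x' = \<eta> * bil (K - K') u u' + \<eta> * bil (K - K') w u' + bil G w p'
      + bil G w q' + k * bil C p p' + bil Q q q' / \<zeta>"
    using HT_correction[OF x(1-3)] x x' by metis
  obtain w' where w': "w' \<in> carrier_vec n"
    and w'_eq: "\<And>v. v \<in> carrier_vec n \<Longrightarrow>
      \<eta> * bil K' w' v = \<eta> * bil (K - K') u' v + bil G v p' + bil G v q'"
    and HT': "bil (H * T) x' x = \<eta> * bil (K - K') u' u + \<eta> * bil (K - K') w' u + bil G w' p
      + bil G w' q + k * bil C p' p + bil Q q' q / \<zeta>"
    using HT_correction[OF x'(1-3)] x x' by metis
  have D: "sym_mat n (K - K')"
    using diff_pos_def by (simp add: pos_def_def)
  have "bil (K - K') u u' = bil (K - K') u' u" "bil (K - K') w u' = bil (K - K') u' w"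
    "bil (K - K') w' u = bil (K - K') u w'" "bil C p p' = bil C p' p" "bil Q q q' = bil Q q' q"
    "bil K' w w' = bil K' w' w"
    using x x' w w' by (auto intro!: bil_sym D symmetric)
  then show "bil (H * T) x x' = bil (H * T) x' x"
    using w_eq[OF w'] w'_eq[OF w] by (simp add: HT HT')
qed

text \<open>Testing the equation for \<open>w\<close> with \<open>w\<close> itself collapses all
  mixed terms into \<open>\<eta> * quad K' w\<close>, leaving a sum of nonnegative terms.\<close>

lemma quad_HT:
  assumes "u \<in> carrier_vec n" "p \<in> carrier_vec m" "q \<in> carrier_vec m"
  obtains w where "w \<in> carrier_vec n"
    "\<And>v. v \<in> carrier_vec n \<Longrightarrow> \<eta> * bil K' w v = \<eta> * bil (K - K') u v + bil G v (p + q)"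
    "quad (H * T) ((u @\<^sub>v p) @\<^sub>v q) =
      \<eta> * quad (K - K') u + \<eta> * quad K' w + k * quad C p + quad Q q / \<zeta>"
proof -
  obtain w where w: "w \<in> carrier_vec n"
    and w_eq: "\<And>v. v \<in> carrier_vec n \<Longrightarrow>
      \<eta> * bil K' w v = \<eta> * bil (K - K') u v + bil G v p + bil G v q"
    and HT: "bil (H * T) ((u @\<^sub>v p) @\<^sub>v q) ((u @\<^sub>v p) @\<^sub>v q) =
      \<eta> * bil (K - K') u u + \<eta> * bil (K - K') w u + bil G w p + bil G w q
      + k * bil C p p + bil Q q q / \<zeta>"
    using HT_correction[OF assms] assms by metis
  have "bil (K - K') w u = bil (K - K') u w"
    using w assms diff_pos_def by (intro bil_sym) (auto simp: pos_def_def)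
  then show thesis
    using w w_eq HT w_eq[OF w] assms
    by (intro that[of w]) (auto simp: quad_eq_bil bil_linear)
qed

section \<open>The lower and upper energy estimates\<close>

text \<open>\<open>v = inv_mat K *\<^sub>v (transpose_mat G *\<^sub>v r)\<close> is the Riesz
  representer of \<open>z \<mapsto> bil G z r\<close> in the \<open>K\<close> inner product. It
  turns the inf-sup condition into a statement about the energy \<open>quad K v\<close>.\<close>

lemma Schur_complement_dual:
  assumes r: "r \<in> carrier_vec m"
  obtains v where "v \<in> carrier_vec n" "\<And>z. z \<in> carrier_vec n \<Longrightarrow> bil K v z = bil G z r"
    "quad (G * inv_mat K * transpose_mat G) r = quad K v"
proof -
  note inv = pos_def_inv_mat[OF K_pd]
  define g where "g = transpose_mat G *\<^sub>v r"
  define v where "v = inv_mat K *\<^sub>v g"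
  have g: "g \<in> carrier_vec n"
    using r carriers by (auto simp: g_def intro!: mult_mat_vec_carrier)
  have v: "v \<in> carrier_vec n"
    using g inv(1) unfolding v_def by (intro mult_mat_vec_carrier)
  have "K *\<^sub>v v = g"
    unfolding v_def assoc_mult_mat_vec[OF carriers(1) inv(1) g, symmetric] inv(2) using g by simp
  then have K: "bil K v z = bil G z r" if "z \<in> carrier_vec n" for z
    using bil_transpose[of r G z] that r by (simp add: bil_def g_def)
  have GT: "transpose_mat G \<in> carrier_mat n m"
    using carriers by simp
  have GK: "G * inv_mat K \<in> carrier_mat m n"
    using carriers inv by simp
  have "(G * inv_mat K * transpose_mat G) *\<^sub>v r = G *\<^sub>v v"
    unfolding assoc_mult_mat_vec[OF GK GT r] g_def[symmetric]
      assoc_mult_mat_vec[OF carriers(7) inv(1) g] v_def ..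
  then have "quad (G * inv_mat K * transpose_mat G) r = bil G v r"
    by (simp add: quad_def bil_def)
  with K v show thesis
    by (intro that[of v]) (auto simp: quad_eq_bil)
qed

lemma quad_Q_add:
  assumes "p \<in> carrier_vec m" "q \<in> carrier_vec m"
  shows "quad Q (p + q) \<le> 2 * (quad Q p + quad Q q)"
  using quad_nonneg(4)[of "p - q"] bil_sym[OF symmetric(3), of p q] assms
  by (simp add: quad_eq_bil bil_linear)

text \<open>The parallelogram identity for \<open>p + q\<close> and \<open>q\<close>, whose
  difference is \<open>p\<close>; the nonnegative term of their sum is dropped.\<close>

lemma quad_Q_le:
  assumes "p \<in> carrier_vec m" "q \<in> carrier_vec m"
  shows "quad Q p \<le> 2 * (quad Q (p + q) + quad Q q)"
proof -
  have "(p + q) - q = p"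
    using assms by (intro eq_vecI) auto
  then show ?thesis
    using quad_nonneg(4)[of "p + q + q"] bil_sym[OF symmetric(3), of p q] assms
    by (simp add: quad_eq_bil bil_linear)
qed

lemma lower_const_pos: "0 < lower_const \<eta> \<zeta> c_g c_r c_s"
  using params inf_sup_const precond_const unfolding lower_const_def
  by (auto intro!: add_pos_nonneg)

lemma quad_lower:
  assumes x: "x \<in> carrier_vec N"
  shows "lower_const \<eta> \<zeta> c_g c_r c_s * quad H x \<le> quad (H * T) x"
proof -
  obtain u p q where upq: "u \<in> carrier_vec n" "p \<in> carrier_vec m" "q \<in> carrier_vec m"
    and x_eq: "x = (u @\<^sub>v p) @\<^sub>v q"
    using x by (meson append_vec3_cases)
  obtain w where w: "w \<in> carrier_vec n"
    and w_eq: "\<And>v. v \<in> carrier_vec n \<Longrightarrow>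
      \<eta> * bil K' w v = \<eta> * bil (K - K') u v + bil G v (p + q)"
    and E: "quad (H * T) x = \<eta> * quad (K - K') u + \<eta> * quad K' w + k * quad C p + quad Q q / \<zeta>"
    using quad_HT[OF upq] x_eq by metis
  define E where "E = quad (H * T) x"
  obtain v where v: "v \<in> carrier_vec n"
    and v_eq: "\<And>z. z \<in> carrier_vec n \<Longrightarrow> bil K v z = bil G z (p + q)"
    and Schur: "quad (G * inv_mat K * transpose_mat G) (p + q) = quad K v"
    using Schur_complement_dual[of "p + q"] upq by auto
  have nonneg: "0 \<le> \<eta> * quad (K - K') u" "0 \<le> \<eta> * quad K' w" "0 \<le> k * quad C p" "0 \<le> quad Q q / \<zeta>"
    using quad_nonneg upq w params by auto
  \<comment> \<open>Both the equation for \<open>v\<close> and the equation for \<open>w\<close> are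
    tested with \<open>v\<close>.\<close>
  have "quad K v = \<eta> * bil K' w v + \<eta> * - bil (K - K') u v"
    using w_eq[OF v] v_eq[OF v] by (simp add: quad_eq_bil)
  \<comment> \<open>With Young weight \<open>\<eta>\<close> the remainders in \<open>v\<close> add
    up to a quarter of \<open>quad K v\<close>, because \<open>K = (K - K') + K'\<close>. The left
    side absorbs it, and the resulting factor 4/3 is rounded up to 2.\<close>
  also have "\<dots> \<le> \<eta> * (\<eta> * quad K' w + quad K' v / (4 * \<eta>))
      + \<eta> * (\<eta> * quad (K - K') u + quad (K - K') v / (4 * \<eta>))"
    using params w v upq K'_pd diff_pos_def
    by (intro add_mono mult_left_mono bil_Young bil_Young_neg pos_def_imp_semidef) auto
  also have "\<dots> = \<eta> * (\<eta> * quad K' w + \<eta> * quad (K - K') u) + quad K v / 4"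
    using params quad_K_split[OF v] by (simp add: field_simps)
  finally have "quad K v \<le> 2 * \<eta> * (\<eta> * quad K' w + \<eta> * quad (K - K') u)"
    using quad_nonneg(1)[OF v] by (simp add: algebra_simps)
  also have "\<dots> \<le> 2 * \<eta> * E"
    using params nonneg by (intro mult_left_mono) (auto simp: E_def E)
  finally have "c_g * quad Q (p + q) \<le> 2 * \<eta> * E"
    using inf_sup[of "p + q"] upq Schur by simp
  then have "quad Q (p + q) \<le> 2 * \<eta> / c_g * E"
    using inf_sup_const by (simp add: field_simps)
  \<comment> \<open>All terms of the energy are nonnegative, so each of them is at most
    \<open>E\<close>.\<close>
  moreover have "quad Q q / \<zeta> \<le> E"
    using nonneg unfolding E_def E by linarith
  then have Qq: "quad Q q \<le> \<zeta> * E"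
    using params by (simp add: field_simps)
  ultimately have "2 * (quad Q (p + q) + quad Q q) \<le> 2 * (2 * \<eta> / c_g * E + \<zeta> * E)"
    by (intro mult_left_mono add_mono) auto
  with quad_Q_le[OF upq(2,3)] have "quad Q p \<le> 2 * (2 * \<eta> / c_g * E + \<zeta> * E)"
    by (rule order.trans)
  then have Qp: "quad Q p \<le> (4 * \<eta> / c_g + 2 * \<zeta>) * E"
    by (simp add: algebra_simps)
  have "quad Q p / \<eta> \<le> (4 * \<eta> / c_g + 2 * \<zeta>) * E / \<eta>"
    using Qp params by (intro divide_right_mono) auto
  moreover have "k * quad C p \<le> E"
    using nonneg unfolding E_def E by simp
  ultimately have "c_r * - quad R' p \<le> ((4 * \<eta> / c_g + 2 * \<zeta>) / \<eta> + 1) * E"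
    using bounds_R_quad(1)[OF upq(2)] by (simp add: algebra_simps)
  then have R: "- quad R' p \<le> ((4 * \<eta> / c_g + 2 * \<zeta>) / \<eta> + 1) / c_r * E"
    using precond_const by (simp add: pos_le_divide_eq mult.commute)
  have "c_s * - quad S' q \<le> (1 / (2 * \<eta>) + 1 / \<zeta>) * (\<zeta> * E)"
    using bounds_S_quad(1)[OF upq(3)] params
    by (elim order.trans) (intro mult_left_mono Qq, auto)
  also have "\<dots> = (\<zeta> / (2 * \<eta>) + 1) * E"
    using params by (simp add: field_simps)
  finally have S: "- quad S' q \<le> (\<zeta> / (2 * \<eta>) + 1) / c_s * E"
    using precond_const by (simp add: pos_le_divide_eq mult.commute)
  have "quad H x = \<eta> * quad (K - K') u - quad R' p - quad S' q"
    using upq by (simp add: quad_eq_bil bil_H x_eq)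
  also have "\<dots> \<le> E + ((4 * \<eta> / c_g + 2 * \<zeta>) / \<eta> + 1) / c_r * E + (\<zeta> / (2 * \<eta>) + 1) / c_s * E"
    using R S nonneg unfolding E_def E by linarith
  also have "\<dots> = inverse (lower_const \<eta> \<zeta> c_g c_r c_s) * E"
    by (simp add: lower_const_def algebra_simps)
  finally show ?thesis
    using lower_const_pos by (simp add: E_def field_simps)
qed

lemma quad_upper:
  assumes x: "x \<in> carrier_vec N"
  shows "quad (H * T) x \<le> upper_const \<eta> \<zeta> C_g C_k C_r C_s * quad H x"
proof -
  obtain u p q where upq: "u \<in> carrier_vec n" "p \<in> carrier_vec m" "q \<in> carrier_vec m"
    and x_eq: "x = (u @\<^sub>v p) @\<^sub>v q"
    using x by (meson append_vec3_cases)
  obtain w where w: "w \<in> carrier_vec n"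
    and w_eq: "\<And>v. v \<in> carrier_vec n \<Longrightarrow>
      \<eta> * bil K' w v = \<eta> * bil (K - K') u v + bil G v (p + q)"
    and E: "quad (H * T) x = \<eta> * quad (K - K') u + \<eta> * quad K' w + k * quad C p + quad Q q / \<zeta>"
    using quad_HT[OF upq] x_eq by metis
  obtain v where v: "v \<in> carrier_vec n"
    and v_eq: "\<And>z. z \<in> carrier_vec n \<Longrightarrow> bil K v z = bil G z (p + q)"
    and Schur: "quad (G * inv_mat K * transpose_mat G) (p + q) = quad K v"
    using Schur_complement_dual[of "p + q"] upq by auto
  \<comment> \<open>The three nonnegative parts of \<open>quad H x\<close>, against which everything
    is measured.\<close>
  define \<delta> \<rho> \<sigma> where "\<delta> = \<eta> * quad (K - K') u" and "\<rho> = - quad R' p" and "\<sigma> = - quad S' q"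
  have nonneg: "0 \<le> quad Q p / \<eta>" "0 \<le> k * quad C p" "0 \<le> quad Q q / \<zeta>" "0 \<le> quad Q q / (2 * \<eta>)"
    using quad_nonneg upq params by auto
  have Cr: "quad Q p / \<eta> + k * quad C p \<le> C_r * \<rho>"
    using bounds_R_quad(2)[OF upq(2)] by (simp add: \<rho>_def)
  have Cs: "quad Q q / (2 * \<eta>) + quad Q q / \<zeta> \<le> C_s * \<sigma>"
    using bounds_S_quad(2)[OF upq(3)] by (simp add: \<sigma>_def algebra_simps)
  have R: "k * quad C p \<le> C_r * \<rho>" and S: "quad Q q / \<zeta> \<le> C_s * \<sigma>"
    using Cr Cs nonneg by linarith+
  have "quad Q p / \<eta> \<le> C_r * \<rho>"
    using Cr nonneg by linarith
  then have Qp: "quad Q p \<le> \<eta> * (C_r * \<rho>)"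
    using params by (simp add: field_simps)
  have "0 \<le> C_r * \<rho>" "0 \<le> C_s * \<sigma>"
    using R S nonneg by linarith+
  then have \<rho>\<sigma>: "0 \<le> \<rho>" "0 \<le> \<sigma>"
    using precond_const by (simp_all add: zero_le_mult_iff)
  have \<delta>: "0 \<le> \<delta>"
    using quad_nonneg upq params by (simp add: \<delta>_def)
  have "\<eta> * quad K' w = \<eta> * bil (K - K') u w + bil K v w"
    using w_eq[OF w] v_eq[OF w] by (simp add: quad_eq_bil)
  \<comment> \<open>The weights \<open>C_k\<close> and \<open>C_k / \<eta>\<close> are chosen so
    that the remainders in \<open>w\<close> amount to at most half of
    \<open>\<eta> * quad K' w\<close>, using that \<open>quad (K - K') w\<close> and
    \<open>quad K w\<close> are both at most \<open>C_k * quad K' w\<close>. The left side absorbs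
    this half.\<close>
  also have "\<dots> \<le> \<eta> * (C_k * quad (K - K') u + quad (K - K') w / (4 * C_k))
      + ((C_k / \<eta>) * quad K v + quad K w / (4 * (C_k / \<eta>)))"
    using params precond_const w v upq K_pd diff_pos_def
    by (intro add_mono mult_left_mono bil_Young pos_def_imp_semidef) auto
  also have "\<dots> = C_k * \<delta> + C_k / \<eta> * quad K v + \<eta> * (quad (K - K') w + quad K w) / (4 * C_k)"
    using params precond_const by (simp add: \<delta>_def field_simps)
  also have "\<eta> * (quad (K - K') w + quad K w) / (4 * C_k) \<le> \<eta> * (2 * (C_k * quad K' w)) / (4 * C_k)"
    using params precond_const quad_K_split[OF w] quad_nonneg(2)[OF w]
      quotient_bounds_pos_def(2)[OF bounds_K K'_pd _ _ w]
    by (intro divide_right_mono mult_left_mono) auto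
  also have "\<eta> * (2 * (C_k * quad K' w)) / (4 * C_k) = \<eta> * quad K' w / 2"
    using precond_const by simp
  finally have "\<eta> * quad K' w \<le> 2 * C_k * \<delta> + 2 * (C_k / \<eta> * quad K v)"
    by simp
  \<comment> \<open>The upper inf-sup constant passes from \<open>quad K v\<close> to
    \<open>quad Q (p + q)\<close>, which the bounds for \<open>R'\<close> and \<open>S'\<close>
    control.\<close>
  moreover have "C_k / \<eta> * quad K v \<le> C_k / \<eta> * (C_g * (2 * (\<eta> * (C_r * \<rho>) + \<zeta> * (C_s * \<sigma>))))"
  proof (intro mult_left_mono)
    have "quad Q q \<le> \<zeta> * (C_s * \<sigma>)"
      using S params by (simp add: field_simps)
    then have "quad Q (p + q) \<le> 2 * (\<eta> * (C_r * \<rho>) + \<zeta> * (C_s * \<sigma>))"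
      using quad_Q_add[OF upq(2,3)] Qp by simp
    then have "C_g * quad Q (p + q) \<le> C_g * (2 * (\<eta> * (C_r * \<rho>) + \<zeta> * (C_s * \<sigma>)))"
      using inf_sup_const by simp
    then show "quad K v \<le> C_g * (2 * (\<eta> * (C_r * \<rho>) + \<zeta> * (C_s * \<sigma>)))"
      using inf_sup[of "p + q"] upq Schur by simp
  qed (use params precond_const in auto)
  ultimately have "quad (H * T) x \<le> \<delta> + 2 * C_k * \<delta>
      + 2 * (C_k / \<eta> * (C_g * (2 * (\<eta> * (C_r * \<rho>) + \<zeta> * (C_s * \<sigma>))))) + C_r * \<rho> + C_s * \<sigma>"
    using R S unfolding E \<delta>_def by linarith
  also have "\<dots> = (1 + 2 * C_k) * \<delta> + C_r * (1 + 4 * C_k * C_g) * \<rho>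
      + C_s * (1 + 4 * C_k * C_g * \<zeta> / \<eta>) * \<sigma>"
    using params by (simp add: field_simps)
  \<comment> \<open>\<open>upper_const\<close> dominates each of the three coefficients because it
    is their sum.\<close>
  also have "\<dots> \<le> upper_const \<eta> \<zeta> C_g C_k C_r C_s * \<delta> + upper_const \<eta> \<zeta> C_g C_k C_r C_s * \<rho>
      + upper_const \<eta> \<zeta> C_g C_k C_r C_s * \<sigma>"
    using params precond_const inf_sup_const \<rho>\<sigma> \<delta>
    by (intro add_mono mult_right_mono) (auto simp: upper_const_def)
  also have "\<dots> = upper_const \<eta> \<zeta> C_g C_k C_r C_s * quad H x"
    using upq by (simp add: \<delta>_def \<rho>_def \<sigma>_def quad_eq_bil bil_H x_eq algebra_simps)
  finally show ?thesis .
qed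

section \<open>Loewner inequalities, spectral inclusion and the family over all mesh sizes\<close>

lemma loewner_and_spectrum_bounds:
  defines "C0 \<equiv> lower_const \<eta> \<zeta> c_g c_r c_s" and "C1 \<equiv> upper_const \<eta> \<zeta> C_g C_k C_r C_s"
  shows "loewner_le N (C0 \<cdot>\<^sub>m H) (H * inv_mat P * A)"
    "loewner_le N (H * inv_mat P * A) (C1 \<cdot>\<^sub>m H)"
    "spectrum (map_mat complex_of_real (inv_mat P * A)) \<subseteq> complex_of_real ` {C0..C1}"
proof -
  have assoc: "H * inv_mat P * A = H * T"
    using H_carrier inv_P(1) A_carrier by (rule assoc_mult_mat)
  have symH: "sym_mat N H"
    using H_pos_def by (simp add: pos_def_def)
  have scaled: "quad (c \<cdot>\<^sub>m H) x = c * quad H x" if "x \<in> carrier_vec N" for c x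
    using that H_carrier by (simp add: quad_eq_bil bil_smult_mat)
  show "loewner_le N (C0 \<cdot>\<^sub>m H) (H * inv_mat P * A)"
    unfolding assoc C0_def
    by (intro loewner_leI sym_mat_smult symH HT_sym) (simp add: scaled quad_lower)
  show "loewner_le N (H * inv_mat P * A) (C1 \<cdot>\<^sub>m H)"
    unfolding assoc C1_def
    by (intro loewner_leI sym_mat_smult symH HT_sym) (simp add: scaled quad_upper)
  show "spectrum (map_mat complex_of_real (inv_mat P * A)) \<subseteq> complex_of_real ` {C0..C1}"
    unfolding C0_def C1_def
    using T_carrier H_pos_def HT_sym quad_lower quad_upper by (rule spectrum_self_adjoint_subset)
qed

end

theorem theorem4p8:
  fixes \<Omega> :: "(real ^ 'd) set"
    and hs :: "real set"
    and X :: "real \<Rightarrow> (real ^ 'd \<Rightarrow> real ^ 'd) set" and M :: "real \<Rightarrow> (real ^ 'd \<Rightarrow> real) set"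
    and nu np :: "real \<Rightarrow> nat"
    and \<phi> :: "real \<Rightarrow> nat \<Rightarrow> real ^ 'd \<Rightarrow> real ^ 'd" and \<psi> :: "real \<Rightarrow> nat \<Rightarrow> real ^ 'd \<Rightarrow> real"
    and K G C Q K' R' S' :: "real \<Rightarrow> real mat"
    and \<eta> \<zeta> k c_g C_g c_k C_k c_r C_r c_s C_s :: real
  assumes dim: "1 \<le> CARD('d)" "CARD('d) \<le> 3"
    and dom: "is_domain \<Omega>"
    and mesh: "hs \<subseteq> {0<..}"
    and X: "\<And>h. h \<in> hs \<Longrightarrow> X h \<subseteq> H1_0_vec \<Omega> \<and> has_basis \<Omega> (X h) (nu h) (\<phi> h)"
    and M: "\<And>h. h \<in> hs \<Longrightarrow> M h \<subseteq> H1 \<Omega> \<inter> L2_0 \<Omega> \<and> has_basis \<Omega> (M h) (np h) (\<psi> h)"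
    and K: "\<And>h. h \<in> hs \<Longrightarrow> K h = form_mat (form_K \<Omega>) (nu h) (\<phi> h) (nu h) (\<phi> h)"
    and G: "\<And>h. h \<in> hs \<Longrightarrow> G h = form_mat (form_G \<Omega>) (np h) (\<psi> h) (nu h) (\<phi> h)"
    and C: "\<And>h. h \<in> hs \<Longrightarrow> C h = form_mat (form_C \<Omega>) (np h) (\<psi> h) (np h) (\<psi> h)"
    and Q: "\<And>h. h \<in> hs \<Longrightarrow> Q h = form_mat (form_Q \<Omega>) (np h) (\<psi> h) (np h) (\<psi> h)"
    and definite: "\<And>h. h \<in> hs \<Longrightarrow>
          pos_def (nu h) (K h) \<and> pos_def (np h) (Q h) \<and> pos_semidef (np h) (C h)"
    and params: "0 < \<eta>" "0 < \<zeta>" "0 \<le> k"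
    and inf_sup_inj: "\<And>h. h \<in> hs \<Longrightarrow>
          inj_on (\<lambda>q. transpose_mat (G h) *\<^sub>v q) (carrier_vec (np h))"
    and inf_sup_const: "0 < c_g" "0 < C_g"
    and inf_sup: "\<And>h q. h \<in> hs \<Longrightarrow> q \<in> carrier_vec (np h) \<Longrightarrow>
          c_g * quad (Q h) q \<le> quad (G h * inv_mat (K h) * transpose_mat (G h)) q \<and>
          quad (G h * inv_mat (K h) * transpose_mat (G h)) q \<le> C_g * quad (Q h) q"
    and precond: "\<And>h. h \<in> hs \<Longrightarrow>
          pos_def (nu h) (K' h) \<and> neg_def (np h) (R' h) \<and> neg_def (np h) (S' h)"
    and precond_const: "0 < c_k" "0 < C_k" "0 < c_r" "0 < C_r" "0 < c_s" "0 < C_s"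
    and bounds_K: "\<And>h. h \<in> hs \<Longrightarrow> quotient_bounds (nu h) (K h) (K' h) c_k C_k"
    and bounds_R: "\<And>h. h \<in> hs \<Longrightarrow>
          quotient_bounds (np h) (mat_R \<eta> k (C h) (Q h)) (R' h) c_r C_r"
    and bounds_S: "\<And>h. h \<in> hs \<Longrightarrow>
          quotient_bounds (np h) (mat_S \<eta> \<zeta> (Q h)) (S' h) c_s C_s"
    and c_k_gt_1: "c_k > 1"
  shows "\<exists>C0 C1 :: real. 0 < C0 \<and> 0 < C1 \<and> (\<forall>h\<in>hs.
      let N = nu h + np h + np h;
          A = block_A (np h) \<eta> \<zeta> k (K h) (G h) (C h) (Q h);
          P = block_P (nu h) (np h) \<eta> (G h) (K' h) (R' h) (S' h);
          H = block_H (nu h) (np h) \<eta> (K h) (K' h) (R' h) (S' h)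
      in loewner_le N (C0 \<cdot>\<^sub>m H) (H * inv_mat P * A)
       \<and> loewner_le N (H * inv_mat P * A) (C1 \<cdot>\<^sub>m H)
       \<and> spectrum (map_mat complex_of_real (inv_mat P * A)) \<subseteq> complex_of_real ` {C0..C1})"
proof (intro exI conjI ballI)
  \<comment> \<open>Both witnesses are fixed before \<open>h\<close> is introduced and are built
    from constants that do not vary with the mesh size.\<close>
  let ?C0 = "lower_const \<eta> \<zeta> c_g c_r c_s" and ?C1 = "upper_const \<eta> \<zeta> C_g C_k C_r C_s"
  show "0 < ?C0"
    using params inf_sup_const precond_const unfolding lower_const_def
    by (auto intro!: add_pos_nonneg)
  show "0 < ?C1"
    using params inf_sup_const precond_const unfolding upper_const_def
    by (auto intro!: add_pos_nonneg)
  fix h assume h: "h \<in> hs"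
  \<comment> \<open>The shape of \<open>G h\<close> is read off from its definition as a form
    matrix.\<close>
  interpret preconditioned_saddle_point "nu h" "np h" "K h" "G h" "C h" "Q h" "K' h" "R' h" "S' h"
    \<eta> \<zeta> k c_g C_g c_k C_k c_r C_r c_s C_s
    using definite[OF h] params inf_sup_const inf_sup[OF h] precond[OF h] precond_const
      bounds_K[OF h] bounds_R[OF h] bounds_S[OF h] c_k_gt_1 G[OF h]
    by unfold_locales (auto simp: form_mat_def)
  show "let N = nu h + np h + np h;
          A = block_A (np h) \<eta> \<zeta> k (K h) (G h) (C h) (Q h);
          P = block_P (nu h) (np h) \<eta> (G h) (K' h) (R' h) (S' h);
          H = block_H (nu h) (np h) \<eta> (K h) (K' h) (R' h) (S' h)
      in loewner_le N (?C0 \<cdot>\<^sub>m H) (H * inv_mat P * A)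
       \<and> loewner_le N (H * inv_mat P * A) (?C1 \<cdot>\<^sub>m H)
       \<and> spectrum (map_mat complex_of_real (inv_mat P * A)) \<subseteq> complex_of_real ` {?C0..?C1}"
    unfolding Let_def using loewner_and_spectrum_bounds by blast
qed

end
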